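(* Let $G$ be a finite simple graph and $e\in E(G)$. Then $$\gamma_{gr}(G)-1\le \gamma_{gr}(G-e)\le \gamma_{gr}(G)+1.$$ Moreover, there exist graphs $G$ such that each of the three values $\gamma_{gr}(G)-1$, $\gamma_{gr}(G)$, $\gamma_{gr}(G)+1$ is attained as $\gamma_{gr}(G-e)$ for some edge $e\in E(G)$ (different edges realizing different values).
   Context: For a vertex $v$ of a graph $G$, $N[v]$ denotes its closed neighborhood. A sequence $S=(v_1,\ldots,v_k)$ of distinct vertices of $G$ is a legal sequence if $N[v_i]\setminus\bigcup_{j=1}^{i-1}N[v_j]\neq\emptyset$ for every $i$. It is a dominating sequence if moreover $\{v_1,\ldots,v_k\}$ is a dominating set of $G$. The Grundy domination number $\gamma_{gr}(G)$ is the maximum length of a legal dominating sequence of $G$. $G-e$ denotes the graph obtained from $G$ by deleting the edge $e$. *)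

theory Defs
  imports Main
begin

text \<open>A graph is given by a vertex set and a set of edges, each edge being an unordered pair of
  vertices. Deleting the edge \<open>e\<close> keeps all vertices and replaces \<open>E\<close> by \<open>E - {e}\<close>.\<close>

definition finite_simple_graph :: "'a set \<Rightarrow> 'a set set \<Rightarrow> bool" where
  "finite_simple_graph V E \<longleftrightarrow> finite V \<and> (\<forall>e\<in>E. e \<subseteq> V \<and> card e = 2)"

definition closed_nbhd :: "'a set \<Rightarrow> 'a set set \<Rightarrow> 'a \<Rightarrow> 'a set" where
  "closed_nbhd V E v = insert v {u \<in> V. {u, v} \<in> E}"

definition dominating_set :: "'a set \<Rightarrow> 'a set set \<Rightarrow> 'a set \<Rightarrow> bool" where
  "dominating_set V E D \<longleftrightarrow> D \<subseteq> V \<and> (\<forall>v\<in>V - D. \<exists>u\<in>D. {u, v} \<in> E)"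

definition legal_sequence :: "'a set \<Rightarrow> 'a set set \<Rightarrow> 'a list \<Rightarrow> bool" where
  "legal_sequence V E S \<longleftrightarrow> set S \<subseteq> V \<and> distinct S \<and>
     (\<forall>i<length S. closed_nbhd V E (S ! i) - (\<Union>j<i. closed_nbhd V E (S ! j)) \<noteq> {})"

definition dominating_sequence :: "'a set \<Rightarrow> 'a set set \<Rightarrow> 'a list \<Rightarrow> bool" where
  "dominating_sequence V E S \<longleftrightarrow> legal_sequence V E S \<and> dominating_set V E (set S)"

text \<open>For a finite graph the maximum is taken over a finite set, since the sequences have distinct
  entries, and over a nonempty one, since a longest legal sequence is dominating.\<close>

definition grundy_domination_number :: "'a set \<Rightarrow> 'a set set \<Rightarrow> nat" where
  "grundy_domination_number V E = Max {length S |S. dominating_sequence V E S}"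

end

theory Submission
  imports Defs
begin

text \<open>A legal sequence is recorded together with a footprint of each entry: a list of pairs
  \<open>(v, u)\<close> with \<open>u \<in> N[v]\<close> and \<open>u\<close> outside the neighbourhoods of all earlier entries. Such a list
  stays one after passing to a sublist, and a longest one is dominating because an undominated
  vertex, footprinting itself, could be appended. If the graph changes only in the edge \<open>ab\<close>, a list
  can be spoilt in two symmetric ways, one for each of \<open>a\<close> and \<open>b\<close>; they exclude each other, and
  each is repaired by dropping a single pair. This gives both inequalities.

  For the example, two pairs contained in the same clique exclude each other, so the length is at
  most the size of any family of cliques covering all vertices and edges. In the triangle \<open>0,1,2\<close>
  with the path \<open>2,3,4\<close> attached this bound is sharp, and it stays sharp after deletion of
  \<open>23\<close>, \<open>34\<close> or \<open>01\<close>.\<close>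

definition footprinted :: "'a set \<Rightarrow> 'a set set \<Rightarrow> ('a \<times> 'a) list \<Rightarrow> bool" where
  "footprinted V E ps \<longleftrightarrow>
     (\<forall>p\<in>set ps. fst p \<in> V \<and> snd p \<in> closed_nbhd V E (fst p)) \<and>
     sorted_wrt (\<lambda>p q. snd q \<notin> closed_nbhd V E (fst p)) ps"

section \<open>Closed neighbourhoods and elementary properties of footprinted lists\<close>

lemma closed_nbhd_self [simp]: "v \<in> closed_nbhd V E v"
  by (simp add: closed_nbhd_def)

lemma closed_nbhd_sym: "v \<in> V \<Longrightarrow> u \<in> closed_nbhd V E v \<Longrightarrow> v \<in> closed_nbhd V E u"
  by (auto simp: closed_nbhd_def insert_commute)

lemma closed_nbhd_delete_edge:
  "closed_nbhd V (E - {{a, b}}) v \<subseteq> closed_nbhd V E v"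
  "u \<in> closed_nbhd V E v \<Longrightarrow> {u, v} \<noteq> {a, b} \<Longrightarrow> u \<in> closed_nbhd V (E - {{a, b}}) v"
  by (auto simp: closed_nbhd_def)

lemma footprinted_nth:
  assumes "footprinted V E ps" "i < j" "j < length ps"
  shows "snd (ps ! j) \<notin> closed_nbhd V E (fst (ps ! i))"
  using assms by (simp add: footprinted_def sorted_wrt_iff_nth_less)

lemma footprinted_nth_mem:
  assumes "footprinted V E ps" "i < length ps"
  shows "fst (ps ! i) \<in> V" "snd (ps ! i) \<in> closed_nbhd V E (fst (ps ! i))"
  using assms by (auto simp: footprinted_def)

text \<open>A footprint lies in the neighbourhood of its own entry, which later footprints avoid.
  Hence discarding all pairs with a given footprint costs at most one pair.\<close>

lemma footprinted_distinct_snd: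
  assumes "footprinted V E ps"
  shows "distinct (map snd ps)"
proof -
  have "snd (ps ! i) \<noteq> snd (ps ! j)" if "i < j" "j < length ps" for i j
    using footprinted_nth[OF assms that] footprinted_nth_mem(2)[OF assms, of i] that by auto
  then show ?thesis
    unfolding distinct_conv_nth by (metis length_map linorder_neqE_nat nth_map)
qed

lemma footprinted_distinct_fst:
  assumes "footprinted V E ps"
  shows "distinct (map fst ps)"
proof -
  have "fst (ps ! i) \<noteq> fst (ps ! j)" if "i < j" "j < length ps" for i j
    using footprinted_nth[OF assms that] footprinted_nth_mem(2)[OF assms that(2)] by auto
  then show ?thesis
    unfolding distinct_conv_nth by (metis length_map linorder_neqE_nat nth_map)
qed

section \<open>The Grundy domination number as a maximum over footprinted lists\<close>

lemma legal_sequence_iff_footprinted: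
  "legal_sequence V E S \<longleftrightarrow> (\<exists>ps. footprinted V E ps \<and> map fst ps = S)"
proof
  assume S: "legal_sequence V E S"
  then have "\<forall>i<length S. \<exists>u. u \<in> closed_nbhd V E (S ! i) \<and> (\<forall>j<i. u \<notin> closed_nbhd V E (S ! j))"
    by (fastforce simp: legal_sequence_def)
  then obtain f where f: "\<And>i. i < length S \<Longrightarrow> f i \<in> closed_nbhd V E (S ! i)"
    "\<And>i j. i < length S \<Longrightarrow> j < i \<Longrightarrow> f i \<notin> closed_nbhd V E (S ! j)"
    by metis
  let ?ps = "map (\<lambda>i. (S ! i, f i)) [0..<length S]"
  have "set S \<subseteq> V"
    using S by (simp add: legal_sequence_def)
  then have "footprinted V E ?ps"
    using f by (auto simp: footprinted_def sorted_wrt_iff_nth_less)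
  moreover have "map fst ?ps = S"
    by (auto intro: nth_equalityI)
  ultimately show "\<exists>ps. footprinted V E ps \<and> map fst ps = S" by blast
next
  assume "\<exists>ps. footprinted V E ps \<and> map fst ps = S"
  then obtain ps where ps: "footprinted V E ps" and S: "S = map fst ps" by blast
  have "set S \<subseteq> V"
    using ps S by (auto simp: footprinted_def)
  moreover have "closed_nbhd V E (S ! i) - (\<Union>j<i. closed_nbhd V E (S ! j)) \<noteq> {}"
    if "i < length S" for i
  proof -
    have "snd (ps ! i) \<in> closed_nbhd V E (S ! i) - (\<Union>j<i. closed_nbhd V E (S ! j))"
      using footprinted_nth[OF ps, of _ i] footprinted_nth_mem(2)[OF ps, of i] that S by auto
    then show ?thesis by blast
  qed
  ultimately show "legal_sequence V E S"
    using footprinted_distinct_fst[OF ps] S by (simp add: legal_sequence_def)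
qed

lemma footprinted_length_le:
  assumes "finite V" "footprinted V E ps"
  shows "length ps \<le> card V"
proof -
  have "set (map fst ps) \<subseteq> V"
    using assms(2) by (auto simp: footprinted_def)
  then show ?thesis
    using card_mono[OF assms(1)] distinct_card[OF footprinted_distinct_fst[OF assms(2)]]
    by (metis length_map)
qed

lemma footprinted_Nil: "footprinted V E []"
  by (simp add: footprinted_def)

lemma longest_footprinted_dominating:
  assumes ps: "footprinted V E ps"
    and longest: "\<And>qs. footprinted V E qs \<Longrightarrow> length qs \<le> length ps"
  shows "dominating_set V E (set (map fst ps))"
proof (rule ccontr)
  assume "\<not> ?thesis"
  moreover have "set (map fst ps) \<subseteq> V"
    using ps by (auto simp: footprinted_def)
  ultimately obtain v where v: "v \<in> V" "v \<notin> set (map fst ps)"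
    "\<And>u. u \<in> set (map fst ps) \<Longrightarrow> {u, v} \<notin> E"
    unfolding dominating_set_def by blast
  then have "footprinted V E (ps @ [(v, v)])"
    using ps
    by (fastforce simp: footprinted_def sorted_wrt_append closed_nbhd_def insert_commute)
  from longest[OF this] show False by simp
qed

text \<open>Domination comes for free at maximal length, so from here on bounds need only build or
  measure footprinted lists.\<close>

lemma grundy_domination_number_footprinted:
  assumes "finite V"
  shows "\<exists>ps. footprinted V E ps \<and> length ps = grundy_domination_number V E"
    and "footprinted V E qs \<Longrightarrow> length qs \<le> grundy_domination_number V E"
proof -
  let ?L = "{length S |S. dominating_sequence V E S}"
  have L: "\<exists>ps. footprinted V E ps \<and> length ps = n" if "n \<in> ?L" for n
    using that unfolding dominating_sequence_def legal_sequence_iff_footprinted by force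
  then have "?L \<subseteq> {..card V}"
    using footprinted_length_le[OF assms] by fastforce
  then have fin: "finite ?L"
    by (rule finite_subset) simp
  \<comment> \<open>The empty list is a candidate and \<open>Suc (card V)\<close> a strict bound on
    all lengths, so a longest list exists.\<close>
  obtain ps where ps: "footprinted V E ps"
    and longest: "\<And>qs. footprinted V E qs \<Longrightarrow> length qs \<le> length ps"
    using ex_has_greatest_nat[of "footprinted V E" "[]" length "Suc (card V)"]
      footprinted_length_le[OF assms] footprinted_Nil
    by (metis less_Suc_eq_le)
  have "dominating_sequence V E (map fst ps)"
    using longest_footprinted_dominating[OF ps longest] ps
    by (auto simp: dominating_sequence_def legal_sequence_iff_footprinted)
  then have mem: "length ps \<in> ?L"
    by (metis (mono_tags, lifting) length_map mem_Collect_eq)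
  then have "grundy_domination_number V E \<in> ?L"
    using Max_in[OF fin] by (auto simp: grundy_domination_number_def)
  then show "\<exists>ps. footprinted V E ps \<and> length ps = grundy_domination_number V E"
    by (rule L)
  show "length qs \<le> grundy_domination_number V E" if "footprinted V E qs"
    using longest[OF that] Max_ge[OF fin mem] by (simp add: grundy_domination_number_def)
qed

section \<open>Deleting and inserting an edge\<close>

lemma length_filter_neq_key:
  assumes "distinct (map f xs)"
  shows "length xs \<le> length (filter (\<lambda>x. f x \<noteq> c) xs) + 1"
  using assms
proof (induction xs)
  case (Cons x xs)
  show ?case
  proof (cases "f x = c")
    case True
    then have "filter (\<lambda>x. f x \<noteq> c) xs = xs"
      using Cons.prems by (auto simp: filter_id_conv image_iff)
    then show ?thesis by simp
  qed (use Cons in auto)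
qed simp

text \<open>Neighbourhoods shrink, so footprints still avoid the earlier ones; only the pairs
  \<open>(a, b)\<close> and \<open>(b, a)\<close> can lose their footprint. Both cannot occur, since
  the footprint of the later one is the vertex of the earlier one.\<close>

lemma footprinted_delete_edge:
  assumes ps: "footprinted V E ps" and ab: "a \<noteq> b"
  shows "\<exists>qs. footprinted V (E - {{a, b}}) qs \<and> length ps \<le> length qs + 1"
proof -
  \<comment> \<open>\<open>c\<close> is the footprint of the pair that spans the deleted edge, if
    there is one.\<close>
  have "\<exists>c\<in>{a, b}. \<forall>p\<in>set ps. snd p \<noteq> c \<longrightarrow> {snd p, fst p} \<noteq> {a, b}"
  proof (rule ccontr)
    assume "\<not> ?thesis"
    then obtain p q where pq: "p \<in> set ps" "q \<in> set ps"
      "snd p = b" "fst p = a" "snd q = a" "fst q = b"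
      using ab by (fastforce simp: doubleton_eq_iff)
    then obtain i j where "i < length ps" "j < length ps" "ps ! i = p" "ps ! j = q"
      by (metis in_set_conv_nth)
    then show False
      using footprinted_nth[OF ps, of i j] footprinted_nth[OF ps, of j i] pq ab
      by (metis closed_nbhd_self linorder_neqE_nat)
  qed
  then obtain c where c: "\<And>p. p \<in> set ps \<Longrightarrow> snd p \<noteq> c \<Longrightarrow> {snd p, fst p} \<noteq> {a, b}"
    by blast
  let ?qs = "filter (\<lambda>p. snd p \<noteq> c) ps"
  have "sorted_wrt (\<lambda>p q. snd q \<notin> closed_nbhd V E (fst p)) ?qs"
    using ps by (simp add: footprinted_def sorted_wrt_filter)
  then have "sorted_wrt (\<lambda>p q. snd q \<notin> closed_nbhd V (E - {{a, b}}) (fst p)) ?qs"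
    by (rule sorted_wrt_mono_rel[rotated]) (use closed_nbhd_delete_edge(1) in fastforce)
  then have "footprinted V (E - {{a, b}}) ?qs"
    using ps c by (auto simp: footprinted_def intro!: closed_nbhd_delete_edge(2))
  then show ?thesis
    using length_filter_neq_key[OF footprinted_distinct_snd[OF ps]] by blast
qed

text \<open>Once chosen, a vertex lies in its own neighbourhood and can no longer be a
  footprint.\<close>

lemma footprinted_before:
  assumes ps: "footprinted V E ps"
    and "i < length ps" "j < length ps" "snd (ps ! i) = fst (ps ! j)"
  shows "i \<le> j"
proof (rule ccontr)
  assume "\<not> i \<le> j"
  then show False
    using footprinted_nth[OF ps, of j i] assms by simp
qed

text \<open>Neighbourhoods grow, so each footprint stays in that of its entry; what can fail is
  avoidance, when one end of the edge is chosen before the other is footprinted.\<close>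

lemma footprinted_insert_edge:
  assumes ps: "footprinted V (E - {{a, b}}) ps" and ab: "a \<noteq> b"
  shows "\<exists>qs. footprinted V E qs \<and> length ps \<le> length qs + 1"
proof -
  let ?bad = "\<lambda>x y. \<exists>i j. i < j \<and> j < length ps \<and> fst (ps ! i) = x \<and> snd (ps ! j) = y"
  have "\<not> (?bad a b \<and> ?bad b a)"
  proof
    assume "?bad a b \<and> ?bad b a"
    \<comment> \<open>Both failures together would give the cycle i < j \<le> k < l \<le> i.\<close>
    then obtain i j k l where "i < j" "j < length ps" "k < l" "l < length ps"
      "snd (ps ! j) = fst (ps ! k)" "snd (ps ! l) = fst (ps ! i)"
      by metis
    then show False
      using footprinted_before[OF ps, of j k] footprinted_before[OF ps, of l i] by simp
  qed
  \<comment> \<open>\<open>c\<close> is the footprinted end in the failure that occurs, and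
    arbitrary if none does.\<close>
  then have "\<exists>c. \<forall>i j. i < j \<longrightarrow> j < length ps \<longrightarrow> snd (ps ! j) \<noteq> c \<longrightarrow>
      {snd (ps ! j), fst (ps ! i)} \<noteq> {a, b}"
    unfolding doubleton_eq_iff by blast
  then obtain c where c: "\<And>i j. i < j \<Longrightarrow> j < length ps \<Longrightarrow> snd (ps ! j) \<noteq> c \<Longrightarrow>
      {snd (ps ! j), fst (ps ! i)} \<noteq> {a, b}"
    by blast
  \<comment> \<open>Exempting the footprint \<open>c\<close> makes the relation true on the whole
    list; filtering then makes the exemption void.\<close>
  let ?P = "\<lambda>p q. snd q \<noteq> c \<longrightarrow> snd q \<notin> closed_nbhd V E (fst p)"
  let ?qs = "filter (\<lambda>p. snd p \<noteq> c) ps"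
  have "sorted_wrt ?P ps"
    unfolding sorted_wrt_iff_nth_less
    using footprinted_nth[OF ps] closed_nbhd_delete_edge(2) c by metis
  then have "sorted_wrt ?P ?qs"
    by (rule sorted_wrt_filter)
  then have "sorted_wrt (\<lambda>p q. snd q \<notin> closed_nbhd V E (fst p)) ?qs"
    by (rule sorted_wrt_mono_rel[rotated]) auto
  then have "footprinted V E ?qs"
    using ps closed_nbhd_delete_edge(1) by (fastforce simp: footprinted_def)
  then show ?thesis
    using length_filter_neq_key[OF footprinted_distinct_snd[OF ps]] by blast
qed

lemma grundy_domination_number_delete_edge:
  assumes "finite_simple_graph V E" "e \<in> E"
  shows "grundy_domination_number V E \<le> grundy_domination_number V (E - {e}) + 1"
    and "grundy_domination_number V (E - {e}) \<le> grundy_domination_number V E + 1"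
proof -
  from assms obtain a b where e: "e = {a, b}" "a \<noteq> b"
    by (metis card_2_iff finite_simple_graph_def)
  have V: "finite V"
    using assms(1) by (simp add: finite_simple_graph_def)
  note gr = grundy_domination_number_footprinted[OF V]
  show "grundy_domination_number V E \<le> grundy_domination_number V (E - {e}) + 1"
    using footprinted_delete_edge[OF _ e(2)] gr[of E] gr[of "E - {e}"] e(1)
    by (metis add_le_mono1 le_trans)
  show "grundy_domination_number V (E - {e}) \<le> grundy_domination_number V E + 1"
    using footprinted_insert_edge[OF _ e(2)] gr[of E] gr[of "E - {e}"] e(1)
    by (metis add_le_mono1 le_trans)
qed

section \<open>Clique covers and the example\<close>

lemma footprinted_length_le_clique_cover:
  assumes ps: "footprinted V E ps" and C: "finite C"
    and clique: "\<And>Q u v. Q \<in> C \<Longrightarrow> u \<in> Q \<Longrightarrow> v \<in> Q \<Longrightarrow> u \<in> closed_nbhd V E v"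
    and cover: "\<And>u v. v \<in> V \<Longrightarrow> u \<in> closed_nbhd V E v \<Longrightarrow> \<exists>Q\<in>C. u \<in> Q \<and> v \<in> Q"
  shows "length ps \<le> card C"
proof -
  have "\<forall>i<length ps. \<exists>Q\<in>C. snd (ps ! i) \<in> Q \<and> fst (ps ! i) \<in> Q"
    using footprinted_nth_mem[OF ps] cover by blast
  then obtain f where f: "\<And>i. i < length ps \<Longrightarrow> f i \<in> C \<and> snd (ps ! i) \<in> f i \<and> fst (ps ! i) \<in> f i"
    by metis
  \<comment> \<open>A common clique would put the later footprint into the neighbourhood of the
    earlier entry.\<close>
  have "f i \<noteq> f j" if "i < j" "j < length ps" for i j
    using footprinted_nth[OF ps that] f[of i] f[of j] clique that by (metis less_trans)
  then have "inj_on f {..<length ps}"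
    by (metis inj_onI lessThan_iff linorder_neqE_nat)
  then have "card {..<length ps} \<le> card C"
    using f C by (intro card_inj_on_le[of f]) auto
  then show ?thesis by simp
qed

text \<open>A list of pairs certifies the lower bound, a clique cover of the same length the upper
  one. The cover is a list, so its cliques need not be shown distinct.\<close>

lemma grundy_domination_number_eqI:
  assumes V: "finite V" and ps: "footprinted V E ps" "length ps = n"
    and Qs: "length Qs = n"
    and clique: "\<And>Q u v. Q \<in> set Qs \<Longrightarrow> u \<in> Q \<Longrightarrow> v \<in> Q \<Longrightarrow> u \<in> closed_nbhd V E v"
    and cover: "\<And>u v. v \<in> V \<Longrightarrow> u \<in> closed_nbhd V E v \<Longrightarrow> \<exists>Q\<in>set Qs. u \<in> Q \<and> v \<in> Q"
  shows "grundy_domination_number V E = n"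
proof -
  obtain qs where qs: "footprinted V E qs" "length qs = grundy_domination_number V E"
    using grundy_domination_number_footprinted(1)[OF V] by blast
  have "length qs \<le> card (set Qs)"
    by (rule footprinted_length_le_clique_cover[OF qs(1) finite_set]) (fact clique, fact cover)
  then have "grundy_domination_number V E \<le> n"
    using card_length[of Qs] qs(2) Qs by simp
  then show ?thesis
    using grundy_domination_number_footprinted(2)[OF V ps(1)] ps(2) by simp
qed

lemma grundy_domination_number_example:
  fixes V :: "nat set" and E :: "nat set set"
  defines "V \<equiv> {0, 1, 2, 3, 4}"
    and "E \<equiv> {{0, 1}, {0, 2}, {1, 2}, {2, 3}, {3, 4}}"
  shows "grundy_domination_number V E = 3"
    and "grundy_domination_number V (E - {{2, 3}}) = 2"
    and "grundy_domination_number V (E - {{3, 4}}) = 3"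
    and "grundy_domination_number V (E - {{0, 1}}) = 4"
proof -
  have V: "finite V"
    by (simp add: V_def)
  note defs = V_def E_def footprinted_def closed_nbhd_def doubleton_eq_iff
  show "grundy_domination_number V E = 3"
    by (rule grundy_domination_number_eqI[OF V, of _ "[(0, 0), (2, 3), (3, 4)]" _
          "[{0, 1, 2}, {2, 3}, {3, 4}]"])
      (auto simp: defs)
  \<comment> \<open>Without the bridge the graph is a disjoint union of two cliques, which cover
    it.\<close>
  show "grundy_domination_number V (E - {{2, 3}}) = 2"
    by (rule grundy_domination_number_eqI[OF V, of _ "[(0, 0), (3, 3)]" _
          "[{0, 1, 2}, {3, 4}]"])
      (auto simp: defs)
  \<comment> \<open>The now isolated vertex 4 needs a clique of its own, since \<open>cover\<close>
    includes the case u = v.\<close>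
  show "grundy_domination_number V (E - {{3, 4}}) = 3"
    by (rule grundy_domination_number_eqI[OF V, of _ "[(0, 0), (2, 3), (4, 4)]" _
          "[{0, 1, 2}, {2, 3}, {4}]"])
      (auto simp: defs)
  \<comment> \<open>The triangle opens into two edges, so the cover needs one more clique; 1 is no
    longer adjacent to 0 and can footprint itself after it.\<close>
  show "grundy_domination_number V (E - {{0, 1}}) = 4"
    by (rule grundy_domination_number_eqI[OF V, of _ "[(0, 0), (1, 1), (2, 3), (3, 4)]" _
          "[{0, 2}, {1, 2}, {2, 3}, {3, 4}]"])
      (auto simp: defs)
qed

theorem theorem2p1:
  shows "(\<forall>(V :: 'a set) E e. finite_simple_graph V E \<and> e \<in> E \<longrightarrow>
            int (grundy_domination_number V E) - 1 \<le> int (grundy_domination_number V (E - {e})) \<and>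
            int (grundy_domination_number V (E - {e})) \<le> int (grundy_domination_number V E) + 1) \<and>
         (\<exists>(V :: nat set) E. finite_simple_graph V E \<and>
            (\<exists>e\<in>E. int (grundy_domination_number V (E - {e})) = int (grundy_domination_number V E) - 1) \<and>
            (\<exists>e\<in>E. int (grundy_domination_number V (E - {e})) = int (grundy_domination_number V E)) \<and>
            (\<exists>e\<in>E. int (grundy_domination_number V (E - {e})) = int (grundy_domination_number V E) + 1))"
proof (intro conjI allI impI, goal_cases)
  case (1 V E e)
  then show ?case
    using grundy_domination_number_delete_edge(1)[of V E e] by linarith
next
  case (2 V E e)
  then show ?case
    using grundy_domination_number_delete_edge(2)[of V E e] by linarith
next
  case 3
  let ?V = "{0, 1, 2, 3, 4} :: nat set"
  let ?E = "{{0, 1}, {0, 2}, {1, 2}, {2, 3}, {3, 4}} :: nat set set"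
  note ex = grundy_domination_number_example
  show ?case
  proof (rule exI[of _ ?V], rule exI[of _ ?E], intro conjI)
    show "finite_simple_graph ?V ?E"
      by (simp add: finite_simple_graph_def)
    show "\<exists>e\<in>?E. int (grundy_domination_number ?V (?E - {e})) =
        int (grundy_domination_number ?V ?E) - 1"
      by (rule bexI[of _ "{2, 3}"], unfold ex) simp_all
    show "\<exists>e\<in>?E. int (grundy_domination_number ?V (?E - {e})) =
        int (grundy_domination_number ?V ?E)"
      by (rule bexI[of _ "{3, 4}"], unfold ex) simp_all
    show "\<exists>e\<in>?E. int (grundy_domination_number ?V (?E - {e})) =
        int (grundy_domination_number ?V ?E) + 1"
      by (rule bexI[of _ "{0, 1}"], unfold ex) simp_all
  qed
qed

end
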